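(* Let $p$ be a prime and let $G$ be a non-abelian group of order $p^7$. Then $\mathrm{Aut}_c(G)=\mathrm{Aut}_z(G)$ if and only if either ($\gamma_2(G)=Z(G)$ and $Z(G)$ is cyclic) or $G$ is a Camina $p$-group of nilpotency class $2$.
   Context: $Z(G)$ is the center and $\gamma_2(G)$ the commutator subgroup of $G$. $\mathrm{Aut}_c(G)$ is the group of all class preserving automorphisms of $G$, i.e. automorphisms $\alpha$ such that $\alpha(x)$ is conjugate to $x$ in $G$ for every $x\in G$. $\mathrm{Aut}_z(G)$ is the group of all central automorphisms of $G$, i.e. automorphisms $\phi$ such that $g^{-1}\phi(g)\in Z(G)$ for every $g\in G$. Commutators are $[x,y]=x^{-1}y^{-1}xy$, and for $y\in G$, $[y,G]$ denotes the set $\{[y,g] : g\in G\}$. For a non-trivial proper normal subgroup $M$ of a finite $p$-group $G$, the pair $(G,M)$ is a Camina pair if $M\subseteq [y,G]$ for all $y\in G\setminus M$; $G$ is a Camina group if $(G,\gamma_2(G))$ is a Camina pair. *)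

theory Defs
  imports "HOL-Algebra.Algebra"
begin

definition center :: "('a, 'b) monoid_scheme \<Rightarrow> 'a set" where
  "center G = {z \<in> carrier G. \<forall>g \<in> carrier G. z \<otimes>\<^bsub>G\<^esub> g = g \<otimes>\<^bsub>G\<^esub> z}"

definition commutator :: "('a, 'b) monoid_scheme \<Rightarrow> 'a \<Rightarrow> 'a \<Rightarrow> 'a" where
  "commutator G x y = inv\<^bsub>G\<^esub> x \<otimes>\<^bsub>G\<^esub> inv\<^bsub>G\<^esub> y \<otimes>\<^bsub>G\<^esub> x \<otimes>\<^bsub>G\<^esub> y"

text \<open>
  The elements of \<^term>\<open>auto G\<close> are extensional (undefined outside
  \<^term>\<open>carrier G\<close>), so an automorphism is determined by its values on the carrier and
  equality of the two sets below is equality of sets of automorphisms.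
\<close>

definition class_preserving_auto :: "('a, 'b) monoid_scheme \<Rightarrow> ('a \<Rightarrow> 'a) set" where
  "class_preserving_auto G =
    {\<alpha> \<in> auto G. \<forall>x \<in> carrier G. \<exists>g \<in> carrier G. \<alpha> x = inv\<^bsub>G\<^esub> g \<otimes>\<^bsub>G\<^esub> x \<otimes>\<^bsub>G\<^esub> g}"

definition central_auto :: "('a, 'b) monoid_scheme \<Rightarrow> ('a \<Rightarrow> 'a) set" where
  "central_auto G = {\<phi> \<in> auto G. \<forall>g \<in> carrier G. inv\<^bsub>G\<^esub> g \<otimes>\<^bsub>G\<^esub> \<phi> g \<in> center G}"

definition finite_p_group :: "nat \<Rightarrow> ('a, 'b) monoid_scheme \<Rightarrow> bool" where
  "finite_p_group p G \<longleftrightarrow> Factorial_Ring.prime p \<and> group G \<and> (\<exists>n::nat. order G = p ^ n)"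

definition camina_pair :: "('a, 'b) monoid_scheme \<Rightarrow> 'a set \<Rightarrow> bool" where
  "camina_pair G M \<longleftrightarrow>
    M \<lhd> G \<and> M \<noteq> {\<one>\<^bsub>G\<^esub>} \<and> M \<noteq> carrier G \<and>
    (\<forall>y \<in> carrier G - M. M \<subseteq> {commutator G y g | g. g \<in> carrier G})"

text \<open>
  The commutator subgroup is \<^term>\<open>derived G (carrier G)\<close>. The library generates it by the
  commutators in the other common convention, which does not change the subgroup; see
  \<open>lower_central_1\<close> below.
\<close>

definition camina_p_group :: "nat \<Rightarrow> ('a, 'b) monoid_scheme \<Rightarrow> bool" where
  "camina_p_group p G \<longleftrightarrow> finite_p_group p G \<and> camina_pair G (derived G (carrier G))"

text \<open>The index is shifted: \<open>lower_central G n\<close> is the term usually written \<open>\<gamma>\<close> with subscript \<open>n + 1\<close>.\<close>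

primrec lower_central :: "('a, 'b) monoid_scheme \<Rightarrow> nat \<Rightarrow> 'a set" where
  "lower_central G 0 = carrier G"
| "lower_central G (Suc n) =
    generate G {commutator G x y | x y. x \<in> lower_central G n \<and> y \<in> carrier G}"

definition has_nilpotency_class :: "('a, 'b) monoid_scheme \<Rightarrow> nat \<Rightarrow> bool" where
  "has_nilpotency_class G c \<longleftrightarrow>
    lower_central G c = {\<one>\<^bsub>G\<^esub>} \<and> (\<forall>d < c. lower_central G d \<noteq> {\<one>\<^bsub>G\<^esub>})"

lemma (in group) lower_central_1: "lower_central G 1 = derived G (carrier G)"
proof -
  have "{commutator G x y | x y. x \<in> carrier G \<and> y \<in> carrier G} = derived_set G (carrier G)"
    (is "?A = ?B")
  proof
    show "?A \<subseteq> ?B"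
    proof
      fix z assume "z \<in> ?A"
      then obtain x y where xy: "x \<in> carrier G" "y \<in> carrier G" "z = commutator G x y" by auto
      then have "z = inv x \<otimes> inv y \<otimes> inv (inv x) \<otimes> inv (inv y)"
        by (simp add: commutator_def)
      with xy show "z \<in> ?B" by (metis (mono_tags, lifting) UN_iff inv_closed singletonI)
    qed
    show "?B \<subseteq> ?A"
    proof
      fix z assume "z \<in> ?B"
      then obtain x y where xy: "x \<in> carrier G" "y \<in> carrier G" "z = x \<otimes> y \<otimes> inv x \<otimes> inv y"
        by auto
      then have "z = commutator G (inv x) (inv y)"
        by (simp add: commutator_def)
      with xy show "z \<in> ?A" by blast
    qed
  qed
  then show ?thesis by (simp add: derived_def)
qed

end

theory Submission
  imports Defs "HOL-Number_Theory.Cong"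
begin

text \<open>
  Inner automorphisms are class preserving, so if class preserving automorphisms are central then
  \<open>G\<close> has class at most \<open>2\<close>, and \<open>G / Z(G)\<close> and \<open>\<gamma>\<^sub>2(G)\<close> have the same exponent \<open>p\<^sup>e\<close>. A character
  \<open>f\<close> of \<open>G\<close> modulo \<open>n\<close> and a central \<open>w\<close> with \<open>w\<^sup>n = 1\<close> give a central endomorphism
  \<open>x \<mapsto> x w\<^bsup>f(x)\<^esup>\<close>; if it is a class preserving automorphism, then \<open>w\<^bsup>f(x)\<^esup>\<close> lies in \<open>[x, G]\<close>. Characters
  of \<open>G / Z(G)\<close> show that \<open>\<gamma>\<^sub>2(G)\<close> contains all elements of \<open>Z(G)\<close> of order dividing \<open>p\<^sup>e\<close>, characters
  of \<open>G / \<gamma>\<^sub>2(G)\<close> then give \<open>\<gamma>\<^sub>2(G) = Z(G)\<close>, and for \<open>e = 1\<close> the characters of \<open>G / Z(G)\<close> yield the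
  Camina condition. If \<open>Z(G)\<close> is not cyclic, it has order at least \<open>p\<^bsup>e+1\<^esup>\<close>, and \<open>G / Z(G)\<close> properly
  contains the product of two cyclic groups of order \<open>p\<^sup>e\<close>, so \<open>3e + 2 \<le> 7\<close> forces \<open>e = 1\<close>.

  Conversely, \<open>x \<mapsto> x\<^sup>-\<^sup>1\<phi>(x)\<close> is a homomorphism trivial on \<open>\<gamma>\<^sub>2(G) = Z(G)\<close> for a central automorphism
  \<open>\<phi>\<close>, so its value at \<open>x\<close> is killed by \<open>|[x, G]|\<close>; in a cyclic center this puts it into \<open>[x, G]\<close>.
\<close>

section \<open>Characters modulo \<open>n\<close>\<close>

text \<open>A homomorphism into the integers modulo n, kept as an integer-valued function that is
  additive up to congruence, so that its values can serve directly as exponents of group elements.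
  The domain \<open>H\<close> is explicit because characters get extended from subgroups.\<close>

definition mod_character :: "('a, 'b) monoid_scheme \<Rightarrow> 'a set \<Rightarrow> nat \<Rightarrow> ('a \<Rightarrow> int) \<Rightarrow> bool" where
  "mod_character G H n f \<longleftrightarrow>
    (\<forall>u \<in> H. \<forall>v \<in> H. [f (u \<otimes>\<^bsub>G\<^esub> v) = f u + f v] (mod int n))"

lemma mod_characterD:
  "mod_character G H n f \<Longrightarrow> u \<in> H \<Longrightarrow> v \<in> H \<Longrightarrow> [f (u \<otimes>\<^bsub>G\<^esub> v) = f u + f v] (mod int n)"
  by (simp add: mod_character_def)

lemma (in group) mod_character_one:
  assumes "subgroup H G" "mod_character G H n f"
  shows "[f \<one> = 0] (mod int n)"
  using mod_characterD[OF assms(2), of \<one> \<one>] subgroup.one_closed[OF assms(1)]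
  by (simp add: cong_iff_dvd_diff)

lemma (in group) mod_character_inv:
  assumes H: "subgroup H G" and f: "mod_character G H n f" and u: "u \<in> H"
  shows "[f (inv u) = - f u] (mod int n)"
proof -
  have uc: "u \<in> carrier G" by (rule subgroup.mem_carrier[OF H u])
  have "[f (u \<otimes> inv u) = f u + f (inv u)] (mod int n)"
    using f H u by (simp add: mod_characterD subgroup.m_inv_closed)
  then have "[f u + f (inv u) = 0] (mod int n)"
    using mod_character_one[OF H f] uc by (metis cong_sym cong_trans r_inv)
  then show ?thesis by (simp add: cong_iff_dvd_diff add.commute)
qed

lemma (in group) mod_character_pow:
  assumes H: "subgroup H G" and f: "mod_character G H n f" and u: "u \<in> H"
  shows "[f (u [^] (k::nat)) = int k * f u] (mod int n)"
proof (induction k)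
  case 0
  then show ?case using mod_character_one[OF H f] by simp
next
  case (Suc k)
  have "u [^] k \<in> H" using H u by (metis int_pow_int subgroup_int_pow_closed)
  then have "[f (u [^] k \<otimes> u) = f (u [^] k) + f u] (mod int n)"
    using f u by (simp add: mod_characterD)
  then have "[f (u [^] k \<otimes> u) = int k * f u + f u] (mod int n)"
    using Suc by (meson cong_add_rcancel cong_trans)
  then show ?case by (simp add: algebra_simps)
qed

lemma (in group) mod_character_int_pow:
  assumes H: "subgroup H G" and f: "mod_character G H n f" and u: "u \<in> H"
  shows "[f (u [^] (k::int)) = k * f u] (mod int n)"
proof (cases k rule: int_cases2)
  case (nonneg j)
  then show ?thesis using mod_character_pow[OF assms, of j] by (simp add: int_pow_int)
next
  case (nonpos j)
  have uc: "u \<in> carrier G" by (rule subgroup.mem_carrier[OF H u])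
  have uj: "u [^] j \<in> H" using H u by (metis int_pow_int subgroup_int_pow_closed)
  have "[f (inv (u [^] j)) = - f (u [^] j)] (mod int n)"
    by (rule mod_character_inv[OF H f uj])
  moreover have "[- f (u [^] j) = - (int j * f u)] (mod int n)"
    using mod_character_pow[OF assms, of j] by (simp only: cong_minus_minus_iff)
  ultimately have "[f (inv (u [^] j)) = - (int j * f u)] (mod int n)"
    by (rule cong_trans)
  then show ?thesis using nonpos uc by (simp add: int_pow_neg_int)
qed

section \<open>Extending characters of finite abelian groups\<close>

text \<open>On the subgroup generated by \<open>H\<close> and x, send h x^i to f(h) + i y. Two
  representations of one element differ by a power of x lying in \<open>H\<close>, and there the
  hypothesis on y makes both values agree.\<close>

lemma (in comm_group) mod_character_adjoin:
  assumes H: "subgroup H G" and f: "mod_character G H n f" and x: "x \<in> carrier G"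
    and y: "\<And>i::int. x [^] i \<in> H \<Longrightarrow> [f (x [^] i) = i * y] (mod int n)"
  obtains K f' where "subgroup K G" "H \<subseteq> K" "x \<in> K" "mod_character G K n f'"
    "\<And>u. u \<in> H \<Longrightarrow> [f' u = f u] (mod int n)" "[f' x = y] (mod int n)"
proof -
  define K where "K = {h \<otimes> x [^] i | h i. h \<in> H \<and> (i::int) \<in> UNIV}"
  note Hc = subgroup.mem_carrier[OF H]
  note Hm = subgroup.m_closed[OF H] and Hi = subgroup.m_inv_closed[OF H] and H1 = subgroup.one_closed[OF H]
  have KI: "h \<otimes> x [^] i \<in> K" if "h \<in> H" for h and i::int using that unfolding K_def by blast
  have prod: "(h \<otimes> x [^] i) \<otimes> (h' \<otimes> x [^] j) = (h \<otimes> h') \<otimes> x [^] (i + j)"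
    if "h \<in> H" "h' \<in> H" for h h' and i j :: int
    using that x by (simp add: Hc int_pow_mult m_ac)
  have inve: "inv (h \<otimes> x [^] i) = inv h \<otimes> x [^] (-i)" if "h \<in> H" for h and i :: int
    using that x by (simp add: Hc inv_mult int_pow_neg)
  have K: "subgroup K G"
  proof (rule subgroupI)
    show "K \<subseteq> carrier G" unfolding K_def using x Hc by auto
    show "K \<noteq> {}" using KI[OF H1] by blast
    fix a assume "a \<in> K"
    then obtain h i where a: "h \<in> H" "a = h \<otimes> x [^] (i::int)" unfolding K_def by blast
    then show "inv a \<in> K" using inve KI Hi by metis
    fix b assume "b \<in> K"
    then obtain h' j where "h' \<in> H" "b = h' \<otimes> x [^] (j::int)" unfolding K_def by blast
    with a show "a \<otimes> b \<in> K" using prod KI Hm by metis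
  qed
  have HK: "H \<subseteq> K"
  proof
    fix h assume "h \<in> H" then show "h \<in> K" using KI[of h 0] Hc by simp
  qed
  have xK: "x \<in> K" using KI[OF H1, of 1] x by simp
  \<comment> \<open>An arbitrary representation of g is chosen; \<open>wd\<close> shows that modulo
    n the value does not depend on it.\<close>
  define f' where "f' g = (let hi = SOME hi. fst hi \<in> H \<and> g = fst hi \<otimes> x [^] (snd hi :: int)
    in f (fst hi) + snd hi * y)" for g
  have wd: "[f h + i * y = f h' + j * y] (mod int n)"
    if "h \<in> H" "h' \<in> H" and e: "h \<otimes> x [^] i = h' \<otimes> x [^] j" for h h' and i j :: int
  proof -
    have hc: "h \<in> carrier G" "h' \<in> carrier G" using that Hc by auto
    have "x [^] (i - j) = inv h \<otimes> (h \<otimes> x [^] i) \<otimes> inv (x [^] j)"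
      using x hc by (simp add: int_pow_diff m_assoc [symmetric])
    also have "\<dots> = inv h \<otimes> h'"
      unfolding e using x hc by (simp add: m_assoc)
    finally have d: "x [^] (i - j) = inv h \<otimes> h'" .
    then have "x [^] (i - j) \<in> H" using that Hm Hi by simp
    then have "[f (inv h \<otimes> h') = (i - j) * y] (mod int n)" using y d by metis
    moreover have "[f (h \<otimes> (inv h \<otimes> h')) = f h + f (inv h \<otimes> h')] (mod int n)"
      using that Hm Hi by (intro mod_characterD[OF f]) auto
    moreover have "h \<otimes> (inv h \<otimes> h') = h'" using hc by (simp add: m_assoc [symmetric])
    ultimately have "[f h' = f h + (i - j) * y] (mod int n)"
      by (metis cong_add_lcancel cong_trans)
    then have "[f h' + j * y = f h + (i - j) * y + j * y] (mod int n)"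
      by (simp only: cong_add_rcancel)
    then show ?thesis by (simp add: algebra_simps cong_sym)
  qed
  have f': "[f' (h \<otimes> x [^] i) = f h + i * y] (mod int n)" if "h \<in> H" for h and i :: int
  proof -
    let ?P = "\<lambda>hi. fst hi \<in> H \<and> h \<otimes> x [^] i = fst hi \<otimes> x [^] (snd hi :: int)"
    have "?P (Eps ?P)" by (rule someI[of ?P "(h, i)"]) (use that in simp)
    then have "[f (fst (Eps ?P)) + snd (Eps ?P) * y = f h + i * y] (mod int n)"
      using that by (intro wd) auto
    then show ?thesis by (simp add: f'_def Let_def)
  qed
  have "mod_character G K n f'" unfolding mod_character_def
  proof (intro ballI)
    fix u v assume "u \<in> K" "v \<in> K"
    then obtain h i h' j where uv: "h \<in> H" "u = h \<otimes> x [^] (i::int)" "h' \<in> H" "v = h' \<otimes> x [^] (j::int)"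
      unfolding K_def by blast
    have "[f' (u \<otimes> v) = f (h \<otimes> h') + (i + j) * y] (mod int n)"
      using f'[of "h \<otimes> h'" "i + j"] uv prod Hm by simp
    also have "[f (h \<otimes> h') + (i + j) * y = (f h + f h') + (i + j) * y] (mod int n)"
      using mod_characterD[OF f uv(1,3)] by (simp only: cong_add_rcancel)
    also have "(f h + f h') + (i + j) * y = (f h + i * y) + (f h' + j * y)"
      by (simp add: algebra_simps)
    also have "[(f h + i * y) + (f h' + j * y) = f' u + f' v] (mod int n)"
      using f'[OF uv(1), of i] f'[OF uv(3), of j] uv by (metis cong_add cong_sym)
    finally show "[f' (u \<otimes> v) = f' u + f' v] (mod int n)" .
  qed
  moreover have "[f' u = f u] (mod int n)" if "u \<in> H" for u
    using f'[OF that, of 0] Hc[OF that] by simp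
  moreover have "[f' x = y] (mod int n)"
  proof -
    have "[f' x = f \<one> + y] (mod int n)" using f'[OF H1, of 1] x by simp
    moreover have "[f \<one> + y = 0 + y] (mod int n)"
      using mod_character_one[OF H f] by (simp only: cong_add_rcancel)
    ultimately show ?thesis by (metis add_0 cong_trans)
  qed
  ultimately show thesis using that K HK xK by blast
qed

text \<open>For normal \<open>H\<close> this m is the order of the coset of x. Taking the least
  positive exponent and dividing with remainder works for any subgroup and avoids the
  quotient.\<close>

lemma (in group) order_modulo:
  assumes H: "subgroup H G" and x: "x \<in> carrier G" and n: "n > 0" "x [^] (n::nat) \<in> H"
  obtains m :: nat where "m > 0" "\<And>i::int. x [^] i \<in> H \<longleftrightarrow> int m dvd i"
    "\<And>i::nat. x [^] i \<in> H \<longleftrightarrow> m dvd i"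
proof -
  define m where "m = (LEAST m::nat. m > 0 \<and> x [^] m \<in> H)"
  have m: "m > 0" "x [^] m \<in> H"
    using LeastI[of "\<lambda>m. m > 0 \<and> x [^] m \<in> H" n] n m_def by auto
  have iff: "x [^] i \<in> H \<longleftrightarrow> int m dvd i" for i :: int
  proof
    assume i: "x [^] i \<in> H"
    have "x [^] (i mod int m) = x [^] (i - int m * (i div int m))"
      by (simp add: minus_mult_div_eq_mod)
    also have "\<dots> = x [^] i \<otimes> inv ((x [^] int m) [^] (i div int m))"
      using x by (simp add: int_pow_diff int_pow_pow)
    finally have "x [^] (i mod int m) \<in> H"
      using i m H by (simp add: int_pow_int subgroup_int_pow_closed subgroup.m_closed subgroup.m_inv_closed)
    then have "x [^] (nat (i mod int m)) \<in> H" using m(1)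
      by (metis int_nat_eq int_pow_int pos_mod_sign of_nat_0_less_iff)
    moreover have "nat (i mod int m) < m" using m(1) by (simp add: nat_less_iff)
    ultimately have "\<not> nat (i mod int m) > 0"
      unfolding m_def by (metis (mono_tags, lifting) not_less_Least)
    moreover have "0 \<le> i mod int m" using m(1) by simp
    ultimately have "i mod int m = 0" by linarith
    then show "int m dvd i" by (simp add: dvd_eq_mod_eq_0)
  next
    assume "int m dvd i"
    then obtain k where "i = int m * k" by (auto elim: dvdE)
    then have "x [^] i = (x [^] m) [^] k" using x by (metis int_pow_int int_pow_pow)
    then show "x [^] i \<in> H" using subgroup_int_pow_closed[OF H m(2)] by simp
  qed
  moreover have "x [^] i \<in> H \<longleftrightarrow> m dvd i" for i :: nat
    using iff[of "int i"] by (simp add: int_pow_int)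
  ultimately show thesis using that m(1) by blast
qed

text \<open>The integers modulo n are injective among abelian groups of exponent dividing n. If x^m
  is the first positive power in \<open>H\<close> and n = m q, then q f(x^m) is 0 modulo n, so m
  divides f(x^m), and the quotient serves as y.\<close>

lemma (in comm_group) mod_character_adjoin_value:
  assumes H: "subgroup H G" and f: "mod_character G H n f" and x: "x \<in> carrier G"
    and n: "n > 0" "x [^] n = \<one>"
  obtains y where "\<And>i::int. x [^] i \<in> H \<Longrightarrow> [f (x [^] i) = i * y] (mod int n)"
proof -
  obtain m where m: "m > 0" "\<And>i::int. x [^] i \<in> H \<longleftrightarrow> int m dvd i"
    "\<And>i::nat. x [^] i \<in> H \<longleftrightarrow> m dvd i"
    using order_modulo[OF H x n(1)] n(2) subgroup.one_closed[OF H] by auto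
  have xm: "x [^] m \<in> H" using m(3) by simp
  have "m dvd n" using m(3)[of n] n(2) subgroup.one_closed[OF H] by simp
  then obtain q where q: "n = m * q" by (auto elim: dvdE)
  have q0: "q > 0" using n q by (cases q) auto
  have "[f ((x [^] m) [^] q) = int q * f (x [^] m)] (mod int n)"
    by (rule mod_character_pow[OF H f xm])
  moreover have "(x [^] m) [^] q = \<one>" using x q n by (simp add: nat_pow_pow)
  ultimately have "[int q * f (x [^] m) = 0] (mod int n)"
    using mod_character_one[OF H f] by (metis cong_sym cong_trans)
  then have "int m * int q dvd f (x [^] m) * int q" using q by (simp add: cong_0_iff mult.commute)
  then have "int m dvd f (x [^] m)" using q0 by simp
  then obtain y where y: "f (x [^] m) = int m * y" by (auto elim: dvdE)
  have "[f (x [^] i) = i * y] (mod int n)" if i: "x [^] i \<in> H" for i :: int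
  proof -
    obtain k where k: "i = int m * k" using i m(2) by (auto elim: dvdE)
    have "x [^] i = (x [^] m) [^] k" using x k by (metis int_pow_int int_pow_pow)
    then have "[f (x [^] i) = k * f (x [^] m)] (mod int n)"
      using mod_character_int_pow[OF H f xm] by metis
    then show ?thesis using y k by (simp add: ac_simps)
  qed
  then show thesis using that by blast
qed

text \<open>Finiteness replaces Zorn's lemma: one element is adjoined at a time, and the complement
  of the domain shrinks strictly.\<close>

lemma (in comm_group) mod_character_extend:
  assumes fin: "finite (carrier G)" and n: "n > 0" "\<And>x. x \<in> carrier G \<Longrightarrow> x [^] n = \<one>"
    and "subgroup H G" "mod_character G H n f"
  shows "\<exists>f'. mod_character G (carrier G) n f' \<and> (\<forall>u \<in> H. [f' u = f u] (mod int n))"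
  using assms(4,5)
proof (induction "card (carrier G - H)" arbitrary: H f rule: less_induct)
  case less
  show ?case
  proof (cases "H = carrier G")
    case True
    then show ?thesis using less.prems by (intro exI[of _ f]) auto
  next
    case False
    then obtain x where x: "x \<in> carrier G" "x \<notin> H" using less.prems subgroup.subset by blast
    obtain y where "\<And>i::int. x [^] i \<in> H \<Longrightarrow> [f (x [^] i) = i * y] (mod int n)"
      using mod_character_adjoin_value[OF less.prems x(1) n(1) n(2)[OF x(1)]] by blast
    from mod_character_adjoin[OF less.prems x(1) this] obtain K f1
      where K: "subgroup K G" "H \<subseteq> K" "x \<in> K" "mod_character G K n f1"
        "\<And>u. u \<in> H \<Longrightarrow> [f1 u = f u] (mod int n)" by metis
    have "card (carrier G - K) < card (carrier G - H)"
      by (rule psubset_card_mono) (use fin K x in auto)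
    from less.hyps[OF this K(1,4)] obtain f'
      where "mod_character G (carrier G) n f'" "\<forall>u \<in> K. [f' u = f1 u] (mod int n)" by blast
    then show ?thesis using K(2,5) by (metis cong_trans subset_iff)
  qed
qed

text \<open>The zero character of the trivial subgroup is extended to a. The prescribed value has
  additive order \<open>ord a\<close> modulo n, hence is consistent with the relations of a, and f
  is faithful on the powers of a.\<close>

lemma (in comm_group) mod_character_exists:
  assumes fin: "finite (carrier G)" and n: "n > 0" "\<And>x. x \<in> carrier G \<Longrightarrow> x [^] n = \<one>"
    and a: "a \<in> carrier G"
  shows "\<exists>f. mod_character G (carrier G) n f \<and> [f a = int (n div ord a)] (mod int n)"
proof -
  have sd: "ord a dvd n" using n a pow_eq_id by blast
  have "[0 = i * int (n div ord a)] (mod int n)" if "a [^] i \<in> {\<one>}" for i :: int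
  proof -
    have "int (ord a) dvd i" using that a int_pow_eq_id by simp
    then obtain k where "i = int (ord a) * k" by (auto elim: dvdE)
    then have "i * int (n div ord a) = int (ord a * (n div ord a)) * k" by simp
    also have "\<dots> = int n * k" using sd by simp
    finally show ?thesis by (simp add: cong_iff_dvd_diff)
  qed
  note val = this
  have zero: "mod_character G {\<one>} n (\<lambda>_. 0)" by (simp add: mod_character_def)
  obtain K f1
    where K: "subgroup K G" "a \<in> K" "mod_character G K n f1" "[f1 a = int (n div ord a)] (mod int n)"
    using mod_character_adjoin[OF triv_subgroup zero a val] by metis
  from mod_character_extend[OF fin n K(1,3)] K(2,4) show ?thesis
    by (meson cong_trans)
qed

section \<open>Characters of abelian quotients\<close>

lemma (in normal) quotient_comm_group:
  assumes "derived G (carrier G) \<subseteq> H"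
  shows "comm_group (G Mod H)"
proof (rule group.group_comm_groupI[OF factorgroup_is_group])
  fix U V assume "U \<in> carrier (G Mod H)" "V \<in> carrier (G Mod H)"
  then obtain x y where xy: "x \<in> carrier G" "y \<in> carrier G" "U = H #> x" "V = H #> y"
    by (auto simp: carrier_FactGroup)
  have "x \<otimes> y \<otimes> inv x \<otimes> inv y \<in> derived G (carrier G)"
    unfolding derived_def using xy by (intro generate.incl) blast
  then have "x \<otimes> y \<otimes> inv x \<otimes> inv y \<in> H" using assms by blast
  moreover have "inv y \<otimes> (y \<otimes> x) = x" using xy by (simp flip: m_assoc)
  then have "x \<otimes> y = (x \<otimes> y \<otimes> inv x \<otimes> inv y) \<otimes> (y \<otimes> x)"
    using xy by (simp add: m_assoc)
  moreover have "H #> (d \<otimes> (y \<otimes> x)) = H #> (y \<otimes> x)" if "d \<in> H" for d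
    using that xy coset_mult_assoc[OF subset mem_carrier[OF that], of "y \<otimes> x"] rcos_const[OF is_group that]
    by simp
  ultimately have "H #> (x \<otimes> y) = H #> (y \<otimes> x)" by metis
  then show "U \<otimes>\<^bsub>G Mod H\<^esub> V = V \<otimes>\<^bsub>G Mod H\<^esub> U" using xy by (simp add: rcos_sum)
qed

text \<open>A character of the abelian quotient by \<open>H\<close> is pulled back. The order s of
  the coset of a is described through powers of a in \<open>H\<close>, so that applications need no
  quotient group.\<close>

lemma (in normal) mod_character_exists_modulo:
  assumes fin: "finite (carrier G)" and der: "derived G (carrier G) \<subseteq> H"
    and n: "n > 0" "\<And>x. x \<in> carrier G \<Longrightarrow> x [^] n \<in> H"
    and a: "a \<in> carrier G" "\<And>i::nat. a [^] i \<in> H \<longleftrightarrow> s dvd i"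
  shows "\<exists>f. mod_character G (carrier G) n f \<and> (\<forall>u \<in> H. [f u = 0] (mod int n)) \<and>
    [f a = int (n div s)] (mod int n)"
proof -
  interpret Q: comm_group "G Mod H" by (rule quotient_comm_group[OF der])
  have coset1: "H #> x = H \<longleftrightarrow> x \<in> H" if "x \<in> carrier G" for x
    using that coset_join1[OF _ that subgroup_axioms] rcos_const[of x] by (auto simp: is_group)
  have pow: "(H #> x) [^]\<^bsub>G Mod H\<^esub> i = \<one>\<^bsub>G Mod H\<^esub> \<longleftrightarrow> x [^] i \<in> H"
    if "x \<in> carrier G" for x and i :: nat
    using that by (simp add: FactGroup_pow coset1)
  have aQ: "H #> a \<in> carrier (G Mod H)" using a by (auto simp: carrier_FactGroup)
  have "Q.ord (H #> a) dvd i \<longleftrightarrow> s dvd i" for i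
    using Q.pow_eq_id[OF aQ] pow[OF a(1)] a(2) by simp
  then have s: "Q.ord (H #> a) = s" by (meson dvd_antisym dvd_refl)
  have "finite (carrier (G Mod H))" using fin by (simp add: carrier_FactGroup)
  moreover have "U [^]\<^bsub>G Mod H\<^esub> n = \<one>\<^bsub>G Mod H\<^esub>" if "U \<in> carrier (G Mod H)" for U
    using that pow n(2) by (auto simp: carrier_FactGroup)
  ultimately obtain f where f: "mod_character (G Mod H) (carrier (G Mod H)) n f"
      "[f (H #> a) = int (n div s)] (mod int n)"
    using Q.mod_character_exists[of n, OF _ n(1) _ aQ] s by metis
  have "mod_character G (carrier G) n (\<lambda>g. f (H #> g))"
    unfolding mod_character_def
  proof (intro ballI)
    fix u v assume "u \<in> carrier G" "v \<in> carrier G"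
    then show "[f (H #> (u \<otimes> v)) = f (H #> u) + f (H #> v)] (mod int n)"
      using mod_characterD[OF f(1), of "H #> u" "H #> v"] by (auto simp: carrier_FactGroup rcos_sum)
  qed
  moreover have "[f (H #> u) = 0] (mod int n)" if "u \<in> H" for u
    using Q.mod_character_one[OF Q.subgroup_self f(1)] that coset1[OF mem_carrier[OF that]] by simp
  ultimately show ?thesis using f(2) by (intro exI[of _ "\<lambda>g. f (H #> g)"]) blast
qed

section \<open>Commutators and central automorphisms\<close>

context group
begin

lemma centerD: "z \<in> center G \<Longrightarrow> z \<in> carrier G"
  "z \<in> center G \<Longrightarrow> g \<in> carrier G \<Longrightarrow> z \<otimes> g = g \<otimes> z"
  by (auto simp: center_def)

lemma subgroup_center: "subgroup (center G) G"
proof (rule subgroupI)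
  show "center G \<subseteq> carrier G" by (auto simp: center_def)
  show "center G \<noteq> {}" by (auto simp: center_def intro!: exI[of _ \<one>])
  fix a assume a: "a \<in> center G"
  have "inv a \<otimes> g = g \<otimes> inv a" if g: "g \<in> carrier G" for g
  proof -
    have "inv a \<otimes> g = inv a \<otimes> (g \<otimes> a) \<otimes> inv a"
      using centerD(1)[OF a] g by (simp add: m_assoc)
    also have "\<dots> = inv a \<otimes> (a \<otimes> g) \<otimes> inv a" using centerD(2)[OF a g] by simp
    also have "\<dots> = g \<otimes> inv a" using centerD(1)[OF a] g by (simp flip: m_assoc)
    finally show ?thesis .
  qed
  then show "inv a \<in> center G" using a by (simp add: center_def)
  fix b assume b: "b \<in> center G"
  show "a \<otimes> b \<in> center G" unfolding center_def
  proof (intro CollectI conjI ballI)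
    show "a \<otimes> b \<in> carrier G" using a b centerD by simp
    fix g assume g: "g \<in> carrier G"
    have "a \<otimes> b \<otimes> g = a \<otimes> (g \<otimes> b)" using a b g by (simp add: centerD(1) centerD(2)[OF b] m_assoc)
    also have "\<dots> = g \<otimes> (a \<otimes> b)"
      using a b g by (simp add: centerD(1) centerD(2)[OF a] m_assoc flip: m_assoc[of a g])
    finally show "a \<otimes> b \<otimes> g = g \<otimes> (a \<otimes> b)" .
  qed
qed

lemma normal_center: "center G \<lhd> G"
proof (rule normal_invI[OF subgroup_center])
  fix x h assume x: "x \<in> carrier G" and h: "h \<in> center G"
  have "x \<otimes> h \<otimes> inv x = h \<otimes> x \<otimes> inv x" using centerD(2)[OF h x] by simp
  then show "x \<otimes> h \<otimes> inv x \<in> center G" using x h by (simp add: m_assoc centerD(1))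
qed

lemma center_int_pow: "z \<in> center G \<Longrightarrow> z [^] (i::int) \<in> center G"
  by (rule subgroup_int_pow_closed[OF subgroup_center])

lemma commutator_closed [simp]:
  "x \<in> carrier G \<Longrightarrow> y \<in> carrier G \<Longrightarrow> commutator G x y \<in> carrier G"
  by (simp add: commutator_def)

lemma conj_eq_mult_commutator:
  "x \<in> carrier G \<Longrightarrow> g \<in> carrier G \<Longrightarrow> inv g \<otimes> x \<otimes> g = x \<otimes> commutator G x g"
  by (simp add: commutator_def m_assoc flip: m_assoc[of x "inv x"])

lemma mult_commutator:
  assumes "x \<in> carrier G" "y \<in> carrier G"
  shows "x \<otimes> y = y \<otimes> x \<otimes> commutator G x y"
proof -
  have "y \<otimes> x \<otimes> commutator G x y = y \<otimes> (inv y \<otimes> x \<otimes> y)"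
    using assms by (simp only: conj_eq_mult_commutator m_assoc commutator_closed m_closed)
  then show ?thesis using assms by (simp flip: m_assoc)
qed

lemma commutator_unique:
  assumes "x \<in> carrier G" "y \<in> carrier G" "c \<in> carrier G" "x \<otimes> y = y \<otimes> x \<otimes> c"
  shows "commutator G x y = c"
  using mult_commutator[OF assms(1,2)] assms by (metis commutator_closed l_cancel m_closed)

lemma commutator_center [simp]:
  assumes "z \<in> center G" "x \<in> carrier G"
  shows "commutator G z x = \<one>" "commutator G x z = \<one>"
  using assms centerD by (auto intro!: commutator_unique)

lemma commutator_self [simp]: "x \<in> carrier G \<Longrightarrow> commutator G x x = \<one>"
  by (rule commutator_unique) auto

lemma centerI_commutator:
  assumes "z \<in> carrier G" "\<And>g. g \<in> carrier G \<Longrightarrow> commutator G z g = \<one>"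
  shows "z \<in> center G"
  unfolding center_def using assms mult_commutator[of z] by auto

lemma commutator_swap:
  assumes "x \<in> carrier G" "y \<in> carrier G"
  shows "commutator G y x = inv (commutator G x y)"
  using assms by (simp add: commutator_def inv_mult_group m_assoc)

lemma derived_eq_generate_commutator:
  "derived G (carrier G) = generate G {commutator G x y | x y. x \<in> carrier G \<and> y \<in> carrier G}"
  using lower_central_1 by simp

lemma commutator_in_derived:
  "x \<in> carrier G \<Longrightarrow> y \<in> carrier G \<Longrightarrow> commutator G x y \<in> derived G (carrier G)"
  unfolding derived_eq_generate_commutator by (rule generate.incl) blast

lemma derived_subset:
  assumes "subgroup H G" "\<And>x y. x \<in> carrier G \<Longrightarrow> y \<in> carrier G \<Longrightarrow> commutator G x y \<in> H"
  shows "derived G (carrier G) \<subseteq> H"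
  unfolding derived_eq_generate_commutator by (rule generate_subgroup_incl[OF _ assms(1)]) (use assms(2) in blast)

lemma subgroup_derived: "subgroup (derived G (carrier G)) G"
  by (rule derived_is_subgroup) simp

text \<open>Serves to carry the exponent bound from single central commutators to the subgroup they
  generate.\<close>

lemma subgroup_center_torsion: "subgroup {u \<in> center G. u [^] (n::nat) = \<one>} G"
proof (rule subgroupI)
  have distrib: "(a \<otimes> b) [^] n = a [^] n \<otimes> b [^] n" if "a \<in> center G" "b \<in> center G" for a b
    using that by (intro pow_mult_distrib) (auto simp: centerD)
  show "{u \<in> center G. u [^] n = \<one>} \<subseteq> carrier G" by (auto simp: center_def)
  show "{u \<in> center G. u [^] n = \<one>} \<noteq> {}" using subgroup.one_closed[OF subgroup_center] by auto
  fix a assume a: "a \<in> {u \<in> center G. u [^] n = \<one>}"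
  then show "inv a \<in> {u \<in> center G. u [^] n = \<one>}"
    using subgroup.m_inv_closed[OF subgroup_center] by (auto simp: centerD nat_pow_inv)
  fix b assume "b \<in> {u \<in> center G. u [^] n = \<one>}"
  with a show "a \<otimes> b \<in> {u \<in> center G. u [^] n = \<one>}"
    using subgroup.m_closed[OF subgroup_center] by (auto simp: distrib)
qed

section \<open>Central automorphisms built from characters\<close>

lemma int_pow_cong:
  assumes "w \<in> carrier G" "w [^] n = \<one>" "[i = j] (mod int n)"
  shows "w [^] i = w [^] j"
proof -
  have "int (ord w) dvd int n" using assms pow_eq_id by simp
  moreover have "int n dvd j - i" using assms(3) by (meson cong_iff_dvd_diff cong_sym)
  ultimately show ?thesis using assms(1) int_pow_eq dvd_trans by blast
qed

text \<open>The congruence on elements of order \<open>p\<close> makes the kernel trivial: a nontrivial kernel would be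
  a central subgroup containing an element of order \<open>p\<close>, which the map fixes.\<close>

lemma central_auto_of_mod_character:
  assumes p: "Factorial_Ring.prime p" and ord: "order G = p ^ k"
    and f: "mod_character G (carrier G) n f"
    and w: "w \<in> center G" "w [^] n = \<one>"
    and triv: "\<And>u. u \<in> center G \<Longrightarrow> u [^] p = \<one> \<Longrightarrow> [f u = 0] (mod int n)"
  shows "(\<lambda>x \<in> carrier G. x \<otimes> w [^] f x) \<in> central_auto G"
proof -
  have fin: "finite (carrier G)"
    using ord p by (metis order_gt_0_iff_finite prime_gt_0_nat zero_less_power)
  note wc = centerD(1)[OF w(1)]
  let ?a = "\<lambda>x \<in> carrier G. x \<otimes> w [^] f x"
  have hom: "?a \<in> hom G G"
  proof (rule homI)
    fix x y assume xy: "x \<in> carrier G" "y \<in> carrier G"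
    have "w [^] f (x \<otimes> y) = w [^] (f x + f y)"
      by (rule int_pow_cong[OF wc w(2) mod_characterD[OF f xy]])
    also have "\<dots> = w [^] f x \<otimes> w [^] f y" using wc by (simp add: int_pow_mult)
    finally have "x \<otimes> y \<otimes> w [^] f (x \<otimes> y) = x \<otimes> (y \<otimes> w [^] f x) \<otimes> w [^] f y"
      using xy wc by (simp add: m_assoc)
    also have "y \<otimes> w [^] f x = w [^] f x \<otimes> y"
      using centerD(2)[OF center_int_pow[OF w(1)]] xy by simp
    finally show "?a (x \<otimes> y) = ?a x \<otimes> ?a y" using xy wc by (simp add: m_assoc)
  qed (use wc in auto)
  interpret h: group_hom G G ?a by unfold_locales (rule hom)
  have "kernel G G ?a = {\<one>}"
  proof (rule ccontr)
    assume "kernel G G ?a \<noteq> {\<one>}"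
    then obtain g where g: "g \<in> carrier G" "?a g = \<one>" "g \<noteq> \<one>"
      using h.hom_one unfolding kernel_def by blast
    \<comment> \<open>A kernel element satisfies g w^(f g) = 1, so it is the inverse of a power of
      the central element w.\<close>
    have "g = inv (w [^] f g)" using g(1,2) wc by (simp add: inv_equality)
    then have gc: "g \<in> center G"
      by (metis center_int_pow subgroup.m_inv_closed subgroup_center w(1))
    obtain j where j: "ord g = p ^ j"
      using ord_dvd_group_order[OF g(1)] ord p divides_primepow_nat by metis
    have "j \<noteq> 0" using j ord_eq_1[OF g(1)] g(3) by auto
    then obtain i where i: "j = Suc i" by (cases j) auto
    \<comment> \<open>Since g has order p^(i+1), this power has order p. It is killed by the map as
      a power of g, yet fixed by the map because f vanishes on it modulo n.\<close>
    define u where "u = g [^] (p ^ i)"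
    have uc: "u \<in> carrier G" using g u_def by simp
    have "u \<in> center G" unfolding u_def
      using center_int_pow[OF gc, of "int (p ^ i)"] by (simp only: int_pow_int)
    moreover have "u [^] p = \<one>"
      unfolding u_def using g(1) i j by (simp add: nat_pow_pow mult.commute pow_eq_id)
    ultimately have "w [^] f u = w [^] (0::int)"
      using int_pow_cong[OF wc w(2) triv] by simp
    moreover have "?a u = \<one>" unfolding u_def using h.hom_nat_pow[OF g(1)] g(2) by simp
    ultimately have "u = \<one>" using uc by simp
    then have "p ^ j dvd p ^ i" unfolding u_def using pow_eq_id[OF g(1)] j by simp
    then show False using i p by (simp add: prime_gt_Suc_0_nat dvd_power_iff_le)
  qed
  then have inj: "inj_on ?a (carrier G)" by (rule h.trivial_ker_imp_inj)
  moreover have "?a ` carrier G = carrier G"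
    by (rule endo_inj_surj[OF fin _ inj]) (use wc in auto)
  ultimately have "?a \<in> auto G"
    unfolding auto_def Bij_def bij_betw_def using hom by auto
  moreover have "inv g \<otimes> ?a g \<in> center G" if "g \<in> carrier G" for g
    using that wc center_int_pow[OF w(1)] by (simp flip: m_assoc)
  ultimately show ?thesis unfolding central_auto_def by blast
qed

end

section \<open>Commutator calculus in class at most two\<close>

locale class_two_group = group +
  assumes commutator_central: "x \<in> carrier G \<Longrightarrow> y \<in> carrier G \<Longrightarrow> commutator G x y \<in> center G"
begin

text \<open>In general [xy, g] is the product of the conjugate of [x, g] by y with [y, g]; the
  conjugation disappears when commutators are central.\<close>

lemma commutator_hom_left:
  assumes g: "g \<in> carrier G"
  shows "(\<lambda>x. commutator G x g) \<in> hom G G"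
proof (rule homI)
  fix x y assume x: "x \<in> carrier G" and y: "y \<in> carrier G"
  let ?c = "commutator G x g" and ?d = "commutator G y g"
  have "x \<otimes> y \<otimes> g = x \<otimes> g \<otimes> y \<otimes> ?d"
    using mult_commutator[OF y g] x y g by (simp add: m_assoc)
  also have "\<dots> = g \<otimes> x \<otimes> (?c \<otimes> y) \<otimes> ?d"
    using mult_commutator[OF x g] x y g by (simp add: m_assoc)
  also have "\<dots> = g \<otimes> (x \<otimes> y) \<otimes> (?c \<otimes> ?d)"
    using centerD(2)[OF commutator_central[OF x g] y] x y g by (simp add: m_assoc)
  finally show "commutator G (x \<otimes> y) g = ?c \<otimes> ?d"
    using x y g by (intro commutator_unique) auto
qed (use g in auto)

lemma commutator_hom_right:
  assumes g: "g \<in> carrier G"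
  shows "(\<lambda>x. commutator G g x) \<in> hom G G"
proof (rule homI)
  fix x y assume x: "x \<in> carrier G" and y: "y \<in> carrier G"
  have "commutator G g (x \<otimes> y) = inv (commutator G x g \<otimes> commutator G y g)"
    using x y g commutator_swap[of "x \<otimes> y" g] hom_mult[OF commutator_hom_left[OF g] x y] by simp
  also have "\<dots> = inv (commutator G y g \<otimes> commutator G x g)"
    using centerD(2)[OF commutator_central[OF x g]] x y g by simp
  also have "\<dots> = commutator G g x \<otimes> commutator G g y"
    using x y g commutator_swap[of x g] commutator_swap[of y g] by (simp add: inv_mult_group)
  finally show "commutator G g (x \<otimes> y) = commutator G g x \<otimes> commutator G g y" .
qed (use g in auto)

lemma
  assumes x: "x \<in> carrier G" and g: "g \<in> carrier G"
  shows commutator_pow_left: "commutator G (x [^] (k::nat)) g = commutator G x g [^] k"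
    and commutator_pow_right: "commutator G g (x [^] (k::nat)) = commutator G g x [^] k"
proof -
  interpret l: group_hom G G "\<lambda>x. commutator G x g" by unfold_locales (rule commutator_hom_left[OF g])
  interpret r: group_hom G G "commutator G g" by unfold_locales (use commutator_hom_right[OF g] in simp)
  show "commutator G (x [^] k) g = commutator G x g [^] k" by (rule l.hom_nat_pow[OF x])
  show "commutator G g (x [^] k) = commutator G g x [^] k" by (rule r.hom_nat_pow[OF x])
qed

lemma commutator_mult_left:
  "x \<in> carrier G \<Longrightarrow> y \<in> carrier G \<Longrightarrow> g \<in> carrier G \<Longrightarrow>
    commutator G (x \<otimes> y) g = commutator G x g \<otimes> commutator G y g"
  using hom_mult[OF commutator_hom_left] by blast

lemma commutator_mult_right:
  "x \<in> carrier G \<Longrightarrow> y \<in> carrier G \<Longrightarrow> g \<in> carrier G \<Longrightarrow>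
    commutator G g (x \<otimes> y) = commutator G g x \<otimes> commutator G g y"
  using hom_mult[OF commutator_hom_right] by blast

lemma derived_subset_center: "derived G (carrier G) \<subseteq> center G"
  by (rule derived_subset[OF subgroup_center commutator_central])

text \<open>The set [g, G] is the image of a homomorphism. Being a subgroup, it has an order to
  which Lagrange's theorem applies.\<close>

lemma commutator_set_subgroup:
  assumes g: "g \<in> carrier G"
  shows "subgroup {commutator G g x | x. x \<in> carrier G} G"
proof -
  interpret r: group_hom G G "commutator G g" by unfold_locales (use commutator_hom_right[OF g] in simp)
  have "{commutator G g x | x. x \<in> carrier G} = commutator G g ` carrier G" by blast
  then show ?thesis using r.img_is_subgroup by simp
qed

end

lemma (in group) class_two_groupI:
  "(\<And>x y. x \<in> carrier G \<Longrightarrow> y \<in> carrier G \<Longrightarrow> commutator G x y \<in> center G) \<Longrightarrow> class_two_group G"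
  by unfold_locales

text \<open>Here \<open>p ^ e\<close> is the exponent of the commutator subgroup, attained by the commutator of \<open>a\<close> and \<open>b\<close>.\<close>

locale class_two_p_group = class_two_group +
  fixes p k e :: nat and a b
  assumes prime_p: "Factorial_Ring.prime p"
    and order_G: "order G = p ^ k"
    and a [simp]: "a \<in> carrier G" and b [simp]: "b \<in> carrier G"
    and ord_commutator: "ord (commutator G a b) = p ^ e"
    and commutator_exponent: "x \<in> carrier G \<Longrightarrow> y \<in> carrier G \<Longrightarrow> commutator G x y [^] (p ^ e) = \<one>"
    and e_pos: "e > 0"
begin

lemma p_gt_1: "p > 1"
  using prime_p by (rule prime_gt_1_nat)

lemma finite_carrier: "finite (carrier G)"
  using order_G p_gt_1 by (metis order_gt_0_iff_finite zero_less_power gr_implies_not0 gr0I)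

lemma pow_exponent_center: "x \<in> carrier G \<Longrightarrow> x [^] (p ^ e) \<in> center G"
  by (rule centerI_commutator) (simp_all add: commutator_pow_left commutator_exponent)

text \<open>By [a^i, b] = [a, b]^i, the coset of a modulo the center has the largest possible order
  p^e, so a character modulo p^e can take the value 1 at a.\<close>

lemma pow_center_iff: "a [^] (i::nat) \<in> center G \<longleftrightarrow> p ^ e dvd i"
proof
  assume "a [^] i \<in> center G"
  then have "commutator G (a [^] i) b = \<one>" by simp
  then show "p ^ e dvd i" using pow_eq_id[of "commutator G a b"] ord_commutator
    by (simp add: commutator_pow_left)
next
  assume "p ^ e dvd i"
  then obtain j where "i = p ^ e * j" by (auto elim: dvdE)
  then have "commutator G (a [^] i) g = \<one>" if "g \<in> carrier G" for g
    using that commutator_exponent[OF a that] by (simp add: commutator_pow_left flip: nat_pow_pow)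
  then show "a [^] i \<in> center G" by (intro centerI_commutator) auto
qed

lemma derived_exponent: "c \<in> derived G (carrier G) \<Longrightarrow> c [^] (p ^ e) = \<one>"
  using derived_subset[OF subgroup_center_torsion[of "p ^ e"]] commutator_central commutator_exponent
  by blast

section \<open>Consequences of central automorphisms being class preserving\<close>

text \<open>A conjugate of x has the form x [x, g], so comparing it with x w^(f x) puts w^(f x) into
  [x, G]. The later arguments choose f, w and x so that this membership is informative or
  absurd.\<close>

lemma class_preserving_mod_character:
  assumes eq: "central_auto G \<subseteq> class_preserving_auto G"
    and f: "mod_character G (carrier G) n f"
    and w: "w \<in> center G" "w [^] n = \<one>"
    and triv: "\<And>u. u \<in> center G \<Longrightarrow> u [^] p = \<one> \<Longrightarrow> [f u = 0] (mod int n)"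
    and x: "x \<in> carrier G"
  obtains g where "g \<in> carrier G" "w [^] f x = commutator G x g"
proof -
  have "(\<lambda>x \<in> carrier G. x \<otimes> w [^] f x) \<in> class_preserving_auto G"
    using central_auto_of_mod_character[OF prime_p order_G f w triv] eq by blast
  then obtain g where g: "g \<in> carrier G" "x \<otimes> w [^] f x = inv g \<otimes> x \<otimes> g"
    using x unfolding class_preserving_auto_def by auto
  then have "x \<otimes> w [^] f x = x \<otimes> commutator G x g" using x by (simp add: conj_eq_mult_commutator)
  then have "w [^] f x = commutator G x g" using x g(1) centerD(1)[OF w(1)] by simp
  with g(1) show thesis by (rule that)
qed

lemma torsion_in_derived:
  assumes eq: "central_auto G \<subseteq> class_preserving_auto G"
    and z: "z \<in> center G" "z [^] (p ^ e) = \<one>"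
  shows "z \<in> derived G (carrier G)"
proof -
  \<comment> \<open>The coset of a has order p^e, so the value at a is p^e div p^e = 1, and z itself
    lands in [a, G].\<close>
  obtain f where f: "mod_character G (carrier G) (p ^ e) f"
      "\<forall>u \<in> center G. [f u = 0] (mod int (p ^ e))" "[f a = int (p ^ e div p ^ e)] (mod int (p ^ e))"
    using normal.mod_character_exists_modulo[OF normal_center finite_carrier derived_subset_center,
        of "p ^ e" a "p ^ e"] pow_exponent_center pow_center_iff p_gt_1 by auto
  obtain g where g: "g \<in> carrier G" "z [^] f a = commutator G a g"
    using class_preserving_mod_character[OF eq f(1) z _ a] f(2) by blast
  have "z [^] f a = z [^] (1::int)"
    using f(3) p_gt_1 by (intro int_pow_cong[OF centerD(1)[OF z(1)] z(2)]) simp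
  then show ?thesis using g commutator_in_derived[OF a g(1)] centerD(1)[OF z(1)] by simp
qed

text \<open>Let p^M be the exponent of the quotient by the derived subgroup and z a central element
  outside the latter. If M exceeds e, a character with value 1 puts a central element of order
  p^(e+1) into the derived subgroup. Otherwise a character nonzero at z yields a class preserving
  automorphism moving the central z.\<close>

lemma center_eq_derived:
  assumes eq: "central_auto G \<subseteq> class_preserving_auto G"
  shows "center G = derived G (carrier G)"
proof (rule ccontr)
  let ?D = "derived G (carrier G)"
  assume "center G \<noteq> ?D"
  then obtain z where z: "z \<in> center G" "z \<notin> ?D" using derived_subset_center by blast
  note zc = centerD(1)[OF z(1)]
  define M where "M = (LEAST M. \<forall>x \<in> carrier G. x [^] (p ^ M) \<in> ?D)"
  have "\<forall>x \<in> carrier G. x [^] (p ^ k) \<in> ?D"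
    using pow_order_eq_1 order_G subgroup.one_closed[OF subgroup_derived] by simp
  then have M: "x [^] (p ^ M) \<in> ?D" if "x \<in> carrier G" for x
    unfolding M_def using that LeastI[of "\<lambda>M. \<forall>x \<in> carrier G. x [^] (p ^ M) \<in> ?D"] by blast
  have pM: "p ^ M > 0" using p_gt_1 by simp
  \<comment> \<open>This makes every character that vanishes on the derived subgroup satisfy the
    condition on central elements of order p.\<close>
  have small: "u \<in> ?D" if "u \<in> center G" "u [^] p = \<one>" for u
  proof (rule torsion_in_derived[OF eq that(1)])
    obtain e' where "e = Suc e'" using e_pos by (cases e) auto
    then have "u [^] (p ^ e) = (u [^] p) [^] (p ^ e')"
      using centerD(1)[OF that(1)] by (simp add: nat_pow_pow)
    then show "u [^] (p ^ e) = \<one>" using that(2) by simp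
  qed
  show False
  proof (cases "e < M")
    case True
    then obtain M' where M': "M = Suc M'" "e \<le> M'" by (cases M) auto
    \<comment> \<open>Minimality of M supplies an element whose order modulo the derived subgroup is
      exactly p^M.\<close>
    then obtain g where g: "g \<in> carrier G" "g [^] (p ^ M') \<notin> ?D"
      using not_less_Least[of M' "\<lambda>M. \<forall>x \<in> carrier G. x [^] (p ^ M) \<in> ?D"] M_def by auto
    obtain m where m: "m > 0" "\<And>i::nat. g [^] i \<in> ?D \<longleftrightarrow> m dvd i"
      using order_modulo[OF subgroup_derived g(1) pM M[OF g(1)]] by metis
    have "m dvd p ^ M" "\<not> m dvd p ^ M'" using m(2) M[OF g(1)] g(2) by auto
    then obtain j where j: "j \<le> M" "m = p ^ j" "\<not> j \<le> M'"
      using divides_primepow_nat[OF prime_p] le_imp_power_dvd by metis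
    then have mM: "m = p ^ M" using M' by (simp add: le_Suc_eq)
    obtain f where f: "mod_character G (carrier G) (p ^ M) f"
        "\<forall>u \<in> ?D. [f u = 0] (mod int (p ^ M))" "[f g = int (p ^ M div p ^ M)] (mod int (p ^ M))"
      using normal.mod_character_exists_modulo[OF derived_self_is_normal finite_carrier subset_refl pM M g(1),
          of "p ^ M"] m(2) mM by auto
    obtain r where r: "ord z = p ^ r"
      using ord_dvd_group_order[OF zc] order_G prime_p divides_primepow_nat by metis
    have "z [^] (p ^ e) \<noteq> \<one>" using torsion_in_derived[OF eq z(1)] z(2) by blast
    then have "\<not> r \<le> e" using pow_eq_id[OF zc] r le_imp_power_dvd by metis
    then have re: "e < r" by simp
    \<comment> \<open>Since z has order p^r with r > e, this power has order p^(e+1): just too large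
      for the derived subgroup, but still dividing p^M.\<close>
    define w where "w = z [^] (p ^ (r - Suc e))"
    have w: "w \<in> center G" unfolding w_def
      using center_int_pow[OF z(1), of "int (p ^ (r - Suc e))"] by (simp only: int_pow_int)
    note wc = centerD(1)[OF w]
    have wpow: "w [^] (p ^ i) = \<one> \<longleftrightarrow> e < i" for i
    proof -
      have "w [^] (p ^ i) = z [^] (p ^ (r - Suc e + i))"
        unfolding w_def using zc by (simp add: nat_pow_pow power_add)
      then have "w [^] (p ^ i) = \<one> \<longleftrightarrow> p ^ r dvd p ^ (r - Suc e + i)" using pow_eq_id[OF zc] r by simp
      also have "\<dots> \<longleftrightarrow> r \<le> r - Suc e + i" using p_gt_1 by (simp add: dvd_power_iff_le)
      also have "\<dots> \<longleftrightarrow> e < i" using re by linarith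
      finally show ?thesis .
    qed
    obtain h where h: "h \<in> carrier G" "w [^] f g = commutator G g h"
      using class_preserving_mod_character[OF eq f(1) w _ _ g(1)] wpow True small f(2) by metis
    have "w [^] f g = w [^] (1::int)"
      using f(3) pM wpow True by (intro int_pow_cong[OF wc, of "p ^ M"]) auto
    then have "w \<in> ?D" using h commutator_in_derived[OF g(1) h(1)] wc by simp
    then show False using derived_exponent wpow[of e] by simp
  next
    case False
    obtain m where m: "m > 0" "\<And>i::nat. z [^] i \<in> ?D \<longleftrightarrow> m dvd i"
      using order_modulo[OF subgroup_derived zc pM M[OF zc]] by metis
    have mM: "m dvd p ^ M" using m(2) M[OF zc] by auto
    have m1: "m \<noteq> 1" using m(2)[of 1] z(2) zc by auto
    obtain f where f: "mod_character G (carrier G) (p ^ M) f"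
        "\<forall>u \<in> ?D. [f u = 0] (mod int (p ^ M))" "[f z = int (p ^ M div m)] (mod int (p ^ M))"
      using normal.mod_character_exists_modulo[OF derived_self_is_normal finite_carrier subset_refl pM M zc m(2)]
      by auto
    \<comment> \<open>Here M is at most e, so this power of a commutator of order p^e has order
      exactly p^M.\<close>
    define w where "w = commutator G a b [^] (p ^ (e - M))"
    have w: "w \<in> center G" unfolding w_def
      using center_int_pow[OF commutator_central[OF a b], of "int (p ^ (e - M))"] by (simp only: int_pow_int)
    note wc = centerD(1)[OF w]
    have ordw: "ord w = p ^ M"
    proof -
      have "ord w = p ^ e div p ^ (e - M)"
        unfolding w_def using ord_pow[of "commutator G a b" "p ^ (e - M)"] ord_commutator p_gt_1
        by (simp add: le_imp_power_dvd)
      also have "\<dots> = p ^ (e - (e - M))" using p_gt_1 by (simp add: power_diff)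
      finally show ?thesis using False by simp
    qed
    then have wM: "w [^] (p ^ M) = \<one>" using pow_eq_id[OF wc] by simp
    obtain h where h: "h \<in> carrier G" "w [^] f z = commutator G z h"
      using class_preserving_mod_character[OF eq f(1) w wM _ zc] small f(2) by metis
    \<comment> \<open>The left side equals w^(f z), which lies in [z, G] and is trivial because z is
      central. As m > 1, this contradicts the order p^M of w.\<close>
    have "w [^] (p ^ M div m) = w [^] int (p ^ M div m)" by (simp only: int_pow_int)
    also have "\<dots> = w [^] f z" using f(3) by (intro int_pow_cong[OF wc wM]) (simp add: cong_sym)
    also have "\<dots> = \<one>" using h z(1) by simp
    finally have "p ^ M dvd p ^ M div m" using pow_eq_id[OF wc] ordw by simp
    moreover have "p ^ M div m > 0" using mM m(1) pM by (metis dvd_div_eq_0_iff gr0I less_not_refl)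
    ultimately have "p ^ M \<le> p ^ M div m" by (rule dvd_imp_le)
    moreover have "p ^ M div m < p ^ M" using m(1) m1 pM by (intro div_less_dividend) auto
    ultimately show False by simp
  qed
qed

text \<open>For e = 1 every noncentral x, not merely a, has the maximal order p modulo the center. A
  character with value 1 at x therefore exists, and it puts each central z into [x, G].\<close>

lemma camina_of_exponent_p:
  assumes eq: "central_auto G \<subseteq> class_preserving_auto G" and e1: "e = 1"
    and x: "x \<in> carrier G" "x \<notin> center G"
  shows "center G \<subseteq> {commutator G x g | g. g \<in> carrier G}"
proof
  fix z assume z: "z \<in> center G"
  have zp: "z [^] p = \<one>" using z center_eq_derived[OF eq] derived_exponent e1 by simp
  have xp: "y [^] p \<in> center G" if "y \<in> carrier G" for y
    using pow_exponent_center[OF that] e1 by simp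
  have p0: "p > 0" using p_gt_1 by simp
  obtain m where m: "m > 0" "\<And>i::nat. x [^] i \<in> center G \<longleftrightarrow> m dvd i"
    using order_modulo[OF subgroup_center x(1) p0 xp[OF x(1)]] by metis
  have "m dvd p" "m \<noteq> 1" using m(2)[of p] m(2)[of 1] xp x by auto
  then have mp: "m = p" using prime_p by (auto simp: prime_nat_iff)
  obtain f where f: "mod_character G (carrier G) p f"
      "\<forall>u \<in> center G. [f u = 0] (mod int p)" "[f x = int (p div p)] (mod int p)"
    using normal.mod_character_exists_modulo[OF normal_center finite_carrier derived_subset_center p0 xp x(1),
        of p] m(2) mp by auto
  obtain g where g: "g \<in> carrier G" "z [^] f x = commutator G x g"
    using class_preserving_mod_character[OF eq f(1) z zp _ x(1)] f(2) by blast
  have "z [^] f x = z [^] (1::int)"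
    using f(3) p_gt_1 by (intro int_pow_cong[OF centerD(1)[OF z] zp]) simp
  then show "z \<in> {commutator G x g | g. g \<in> carrier G}" using g centerD(1)[OF z] by auto
qed

text \<open>If the cosets of the \<open>a\<^sup>i b\<^sup>j\<close> exhausted \<open>G / Z(G)\<close>, the commutator subgroup would be generated
  by \<open>[a, b]\<close>.\<close>

lemma order_bound_noncyclic:
  assumes Z: "center G = derived G (carrier G)"
    and nc: "\<not> cyclic_group (G\<lparr>carrier := center G\<rparr>)"
  shows "3 * e + 2 \<le> k"
proof -
  let ?c = "commutator G a b" and ?n = "p ^ e" and ?Z = "center G"
  let ?C = "generate G {?c}"
  have cc: "?c \<in> carrier G" and cZ: "?c \<in> ?Z" using commutator_central by auto
  have C: "subgroup ?C G" using cc by (intro generate_is_subgroup) auto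
  have cC: "?c \<in> ?C" by (rule generate.incl) simp
  have CZ: "?C \<subseteq> ?Z" using cZ by (intro generate_subgroup_incl[OF _ subgroup_center]) auto
  have finZ: "finite ?Z" using finite_carrier by (rule rev_finite_subset) (auto simp: center_def)
  have ne: "?C \<noteq> ?Z"
  proof
    assume "?C = ?Z"
    have "group (G\<lparr>carrier := ?Z\<rparr>)" by (rule subgroup_imp_group[OF subgroup_center])
    moreover have "?Z = range (\<lambda>i::int. ?c [^]\<^bsub>G\<lparr>carrier := ?Z\<rparr>\<^esub> i)"
      using \<open>?C = ?Z\<close> generate_pow[OF cc] int_pow_consistent[OF subgroup_center cZ]
      by (simp add: full_SetCompr_eq)
    ultimately have "cyclic_group (G\<lparr>carrier := ?Z\<rparr>)"
      using cZ by (auto simp: group.cyclic_group intro!: bexI[of _ ?c])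
    with nc show False ..
  qed
  have cardC: "card ?C = ?n" using generate_pow_card[OF cc] ord_commutator by simp
  have lag: "card (rcosets ?Z) * card ?Z = p ^ k" using lagrange[OF subgroup_center] order_G by simp
  then obtain s where s: "card ?Z = p ^ s" by (metis divides_primepow_nat dvd_triv_right prime_p)
  obtain t where t: "card (rcosets ?Z) = p ^ t" using lag by (metis divides_primepow_nat dvd_triv_left prime_p)
  have "p ^ (t + s) = p ^ k" using lag s t by (simp add: power_add)
  then have k: "k = t + s" using p_gt_1 by (simp add: power_inject_exp)
  have "card ?C < card ?Z" using CZ ne finZ by (intro psubset_card_mono) auto
  then have es: "e < s" using cardC s p_gt_1 by simp
  \<comment> \<open>Indices i, j below p^e give cosets of a^i b^j. By \<open>comb\<close> and
    \<open>coma\<close>, commutators with b and a recover [a, b]^i and [a, b]^j, which makes these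
    cosets distinct.\<close>
  define F where "F ij = ?Z #> (a [^] fst ij \<otimes> b [^] (snd ij :: nat))" for ij :: "nat \<times> nat"
  let ?S = "{..<?n} \<times> {..<?n}"
  have cl: "a [^] i \<otimes> b [^] j \<in> carrier G" for i j :: nat by simp
  have comb: "commutator G (z \<otimes> (a [^] i \<otimes> b [^] j)) b = ?c [^] i"
    and coma: "commutator G a (z \<otimes> (a [^] i \<otimes> b [^] j)) = ?c [^] j" if "z \<in> ?Z" for z and i j :: nat
    using that by (simp_all add: commutator_mult_left commutator_mult_right commutator_pow_left
        commutator_pow_right centerD(1))
  have oneZ: "\<one> \<in> ?Z" by (rule subgroup.one_closed[OF subgroup_center])
  have inj: "inj_on F ?S"
  proof (rule inj_onI)
    fix ij ij' assume ij: "ij \<in> ?S" "ij' \<in> ?S" "F ij = F ij'"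
    obtain i j i' j' where e: "ij = (i, j)" "ij' = (i', j')" by (cases ij, cases ij')
    have "\<one> \<otimes> (a [^] i \<otimes> b [^] j) \<in> F ij"
      using oneZ unfolding F_def r_coset_def e by (intro UN_I[of \<one>]) auto
    then have "\<one> \<otimes> (a [^] i \<otimes> b [^] j) \<in> F ij'" using ij(3) by simp
    then obtain z where z: "z \<in> ?Z" "\<one> \<otimes> (a [^] i \<otimes> b [^] j) = z \<otimes> (a [^] i' \<otimes> b [^] j')"
      unfolding F_def r_coset_def e by auto
    have "?c [^] i = ?c [^] i'" "?c [^] j = ?c [^] j'"
      using comb[OF oneZ, of i j] comb[OF z(1), of i' j'] coma[OF oneZ, of i j] coma[OF z(1), of i' j'] z(2)
      by simp_all
    moreover have "inj_on (\<lambda>i::nat. ?c [^] i) {0..?n - 1}" using ord_inj[OF cc] ord_commutator by simp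
    moreover have "i \<in> {0..?n - 1}" "i' \<in> {0..?n - 1}" "j \<in> {0..?n - 1}" "j' \<in> {0..?n - 1}"
      using ij(1,2) e by auto
    ultimately show "ij = ij'" using e by (auto dest: inj_onD)
  qed
  have FS: "F ` ?S \<subseteq> rcosets ?Z" unfolding F_def by (auto simp: RCOSETS_def intro!: bexI[OF _ cl])
  have finR: "finite (rcosets ?Z)" using finite_carrier by (simp add: RCOSETS_def)
  have cardF: "card (F ` ?S) = p ^ (2 * e)"
    using card_image[OF inj] by (simp add: card_cartesian_product power_add mult_2)
  have neR: "F ` ?S \<noteq> rcosets ?Z"
  proof
    assume all: "F ` ?S = rcosets ?Z"
    have form: "\<exists>z i j. z \<in> ?Z \<and> x = z \<otimes> (a [^] (i::nat) \<otimes> b [^] (j::nat))" if x: "x \<in> carrier G" for x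
    proof -
      have "?Z #> x \<in> F ` ?S" unfolding all using x by (auto simp: RCOSETS_def)
      then obtain i j where "?Z #> x = ?Z #> (a [^] (i::nat) \<otimes> b [^] (j::nat))" unfolding F_def by auto
      moreover have "x \<in> ?Z #> x" by (rule rcos_self[OF x subgroup_center])
      ultimately show ?thesis unfolding r_coset_def by blast
    qed
    have Cpow: "?c [^] i \<in> ?C" for i :: nat
      using subgroup_int_pow_closed[OF C cC, of "int i"] by (simp only: int_pow_int)
    have genC: "commutator G x b \<in> ?C" "commutator G a x \<in> ?C" if "x \<in> carrier G" for x
      using form[OF that] comb coma Cpow by metis+
    have "commutator G x y \<in> ?C" if x: "x \<in> carrier G" and y: "y \<in> carrier G" for x y
    proof -
      obtain z i j where z: "z \<in> ?Z" and yf: "y = z \<otimes> (a [^] (i::nat) \<otimes> b [^] (j::nat))"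
        using form[OF y] by blast
      have 1: "commutator G x a \<in> ?C"
        using commutator_swap[OF a x] subgroup.m_inv_closed[OF C genC(2)[OF x]] by simp
      have pw: "u [^] (i::nat) \<in> ?C" if "u \<in> ?C" for u i
        using subgroup_int_pow_closed[OF C that, of "int i"] by (simp only: int_pow_int)
      \<comment> \<open>Expanding y leaves only commutators of x with a and b. These lie in
        \<open>?C\<close> by expanding x in turn.\<close>
      have "commutator G x y = commutator G x a [^] i \<otimes> commutator G x b [^] j"
        using z x unfolding yf by (simp add: commutator_mult_right commutator_pow_right centerD(1))
      then show ?thesis using subgroup.m_closed[OF C pw[OF 1] pw[OF genC(1)[OF x]]] by simp
    qed
    then have "?Z \<subseteq> ?C" unfolding Z by (rule derived_subset[OF C])
    then show False using CZ ne by blast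
  qed
  have "card (F ` ?S) < card (rcosets ?Z)"
    using FS neR finR by (intro psubset_card_mono) auto
  \<comment> \<open>The quotient by the center has order p^t with t at least 2e + 1, and the center
    has order p^s with s at least e + 1; the exponents add up to k.\<close>
  then have "2 * e < t" using cardF t p_gt_1 by simp
  then show ?thesis using es k by simp
qed

end

section \<open>The characterization\<close>

text \<open>Take a commutator of maximal order. All orders are powers of p, so the maximum is
  divisible by every other one; it exceeds 1 because the group is not abelian.\<close>

lemma (in class_two_group) class_two_p_groupE:
  assumes p: "Factorial_Ring.prime p" "order G = p ^ k" and nonab: "\<not> comm_group G"
  obtains e a b where "class_two_p_group G p k e a b"
proof -
  have fin: "finite (carrier G)"
    using p by (metis order_gt_0_iff_finite prime_gt_0_nat zero_less_power)
  let ?O = "(\<lambda>(x, y). ord (commutator G x y)) ` (carrier G \<times> carrier G)"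
  have O: "finite ?O" "?O \<noteq> {}" using fin by auto
  then have "Max ?O \<in> ?O" by (rule Max_in)
  then obtain a b where ab: "a \<in> carrier G" "b \<in> carrier G" "ord (commutator G a b) = Max ?O" by auto
  obtain e where e: "ord (commutator G a b) = p ^ e"
    using ord_dvd_group_order[of "commutator G a b"] ab p divides_primepow_nat by auto
  have ex: "commutator G x y [^] (p ^ e) = \<one>" if xy: "x \<in> carrier G" "y \<in> carrier G" for x y
  proof -
    obtain j where j: "ord (commutator G x y) = p ^ j"
      using ord_dvd_group_order[of "commutator G x y"] xy p divides_primepow_nat by auto
    have "ord (commutator G x y) \<le> Max ?O" using xy by (intro Max_ge[OF O(1)]) auto
    then have "p ^ j \<le> p ^ e" using j e ab by simp
    then have "j \<le> e" using p(1) by (simp add: prime_gt_Suc_0_nat power_increasing_iff)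
    then show ?thesis using pow_eq_id[of "commutator G x y"] xy j by (simp add: le_imp_power_dvd)
  qed
  have "e > 0"
  proof (rule ccontr)
    assume "\<not> e > 0"
    then have "commutator G x y = \<one>" if "x \<in> carrier G" "y \<in> carrier G" for x y
      using ex[OF that] that by simp
    then have "x \<otimes> y = y \<otimes> x" if "x \<in> carrier G" "y \<in> carrier G" for x y
      using mult_commutator[OF that] that by simp
    then have "comm_group G" by (rule group_comm_groupI)
    with nonab show False ..
  qed
  then have "class_two_p_group G p k e a b"
    using p ab e ex by unfold_locales auto
  then show thesis by (rule that)
qed

text \<open>Conjugation by g is class preserving, and its centrality at x says precisely that [x, g]
  is central.\<close>

lemma (in group) class_two_of_class_preserving_subset:
  assumes "class_preserving_auto G \<subseteq> central_auto G"
  shows "class_two_group G"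
proof (rule class_two_groupI)
  fix x g assume x: "x \<in> carrier G" and g: "g \<in> carrier G"
  let ?a = "\<lambda>x \<in> carrier G. inv g \<otimes> x \<otimes> g"
  have canc: "g \<otimes> (inv g \<otimes> y) = y" "inv g \<otimes> (g \<otimes> y) = y" if "y \<in> carrier G" for y
    using that g by (simp_all flip: m_assoc)
  have "?a \<in> hom G G" by (rule homI) (use g in \<open>auto simp: m_assoc canc\<close>)
  moreover have "bij_betw ?a (carrier G) (carrier G)"
    by (rule bij_betw_byWitness[where f' = "\<lambda>x. g \<otimes> x \<otimes> inv g"]) (use g in \<open>auto simp: m_assoc canc\<close>)
  ultimately have "?a \<in> class_preserving_auto G"
    using g unfolding class_preserving_auto_def auto_def Bij_def by auto
  then have "?a \<in> central_auto G" using assms by blast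
  then have "inv x \<otimes> (inv g \<otimes> x \<otimes> g) \<in> center G"
    using x unfolding central_auto_def by auto
  then show "commutator G x g \<in> center G" using x g by (simp add: commutator_def m_assoc)
qed

lemma (in class_two_group) class_preserving_subset_central:
  "class_preserving_auto G \<subseteq> central_auto G"
proof
  fix f assume f: "f \<in> class_preserving_auto G"
  have "inv x \<otimes> f x \<in> center G" if x: "x \<in> carrier G" for x
  proof -
    obtain g where g: "g \<in> carrier G" "f x = inv g \<otimes> x \<otimes> g"
      using f x unfolding class_preserving_auto_def by auto
    then have "inv x \<otimes> f x = commutator G x g" using x by (simp add: commutator_def m_assoc)
    then show ?thesis using commutator_central[OF x g(1)] by simp
  qed
  then show "f \<in> central_auto G" using f unfolding central_auto_def class_preserving_auto_def by auto
qed

section \<open>When central automorphisms are class preserving\<close>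

lemma (in group) central_subset_class_preserving:
  assumes "\<And>f x. f \<in> central_auto G \<Longrightarrow> x \<in> carrier G \<Longrightarrow>
    \<exists>g \<in> carrier G. inv x \<otimes> f x = commutator G x g"
  shows "central_auto G \<subseteq> class_preserving_auto G"
proof
  fix f assume f: "f \<in> central_auto G"
  have "\<exists>g \<in> carrier G. f x = inv g \<otimes> x \<otimes> g" if x: "x \<in> carrier G" for x
  proof -
    obtain g where g: "g \<in> carrier G" "inv x \<otimes> f x = commutator G x g" using assms[OF f x] by blast
    have "f x \<in> carrier G" using f x unfolding central_auto_def auto_def by (auto simp: hom_def)
    then have "f x = x \<otimes> commutator G x g" using g x by (simp flip: g(2) m_assoc)
    then show ?thesis using g(1) x by (auto simp: conj_eq_mult_commutator)
  qed
  then show "f \<in> class_preserving_auto G" using f unfolding central_auto_def class_preserving_auto_def by auto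
qed

lemma (in group) central_auto_difference_hom:
  assumes f: "f \<in> central_auto G"
  shows "(\<lambda>x. inv x \<otimes> f x) \<in> hom G G"
proof (rule homI)
  have fc: "f x \<in> carrier G" if "x \<in> carrier G" for x
    using f that unfolding central_auto_def auto_def by (auto simp: hom_def)
  then show "inv x \<otimes> f x \<in> carrier G" if "x \<in> carrier G" for x using that by simp
  fix x y assume x: "x \<in> carrier G" and y: "y \<in> carrier G"
  have c: "inv x \<otimes> f x \<in> center G" using f x unfolding central_auto_def by auto
  have "f (x \<otimes> y) = f x \<otimes> f y" using f x y unfolding central_auto_def auto_def by (auto simp: hom_def)
  then have "inv (x \<otimes> y) \<otimes> f (x \<otimes> y) = inv y \<otimes> (inv x \<otimes> f x) \<otimes> f y"
    using x y fc by (simp add: inv_mult_group m_assoc)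
  also have "\<dots> = (inv x \<otimes> f x) \<otimes> inv y \<otimes> f y" using centerD(2)[OF c] y by simp
  finally show "inv (x \<otimes> y) \<otimes> f (x \<otimes> y) = (inv x \<otimes> f x) \<otimes> (inv y \<otimes> f y)"
    using x y fc by (simp add: m_assoc)
qed

text \<open>The homomorphism x -> x^(-1) f(x) has central, hence commuting, values, so its kernel
  contains all commutators.\<close>

lemma (in group) central_auto_fixes_derived:
  assumes f: "f \<in> central_auto G" and c: "c \<in> derived G (carrier G)"
  shows "inv c \<otimes> f c = \<one>"
proof -
  define h where "h x = inv x \<otimes> f x" for x
  have "h \<in> hom G G" unfolding h_def[abs_def] by (rule central_auto_difference_hom[OF f])
  then interpret h: group_hom G G h by unfold_locales
  have "commutator G x y \<in> kernel G G h" if x: "x \<in> carrier G" and y: "y \<in> carrier G" for x y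
  proof -
    have "h x \<in> center G" using f x unfolding central_auto_def h_def by auto
    then have comm: "h x \<otimes> h y = h y \<otimes> h x" using h.hom_closed[OF y] by (rule centerD(2))
    have "h (x \<otimes> y) = h (y \<otimes> x \<otimes> commutator G x y)" using mult_commutator[OF x y] by simp
    then have "h y \<otimes> h x \<otimes> h (commutator G x y) = h y \<otimes> h x \<otimes> \<one>"
      using comm x y by simp
    then have "h (commutator G x y) = \<one>"
      using l_cancel[of "h y \<otimes> h x" "h (commutator G x y)" \<one>] x y by simp
    then show ?thesis unfolding kernel_def using x y by simp
  qed
  from derived_subset[OF h.subgroup_kernel this] c show ?thesis unfolding kernel_def h_def by auto
qed

text \<open>In a finite cyclic group at most t elements satisfy u^t = 1. For t = |T|, Lagrange's
  theorem says that all elements of \<open>T\<close> do, so \<open>T\<close> is the whole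
  t-torsion.\<close>

lemma (in group) cyclic_torsion_in_subgroup:
  assumes fin: "finite (carrier G)" and c: "c \<in> carrier G"
    and T: "subgroup T G" "T \<subseteq> generate G {c}"
    and u: "u \<in> generate G {c}" "u [^] card T = \<one>"
  shows "u \<in> T"
proof -
  let ?N = "ord c" and ?t = "card T"
  have N: "?N > 0" using ord_ge_1[OF fin c] by simp
  have t0: "?t > 0" using subgroup.one_closed[OF T(1)] finite_subset[OF subgroup.subset[OF T(1)] fin]
    by (auto simp: card_gt_0_iff)
  have Tt: "v [^] ?t = \<one>" if "v \<in> T" for v
  proof -
    interpret H: group "G\<lparr>carrier := T\<rparr>" by (rule subgroup_imp_group[OF T(1)])
    have "v [^]\<^bsub>G\<lparr>carrier := T\<rparr>\<^esub> ?t = \<one>"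
      using H.pow_order_eq_1[of v] that by (simp add: order_def)
    then show ?thesis by (simp add: nat_pow_consistent[symmetric])
  qed
  define d where "d = gcd ?N ?t"
  have d0: "d > 0" "d \<le> ?t" using N t0 unfolding d_def by (simp_all add: dvd_imp_le)
  obtain q t' where q: "?N = q * d" "?t = t' * d" "coprime q t'"
    using gcd_coprime_exists[of ?N ?t] N unfolding d_def by auto
  \<comment> \<open>These d = gcd(N, t) powers contain the t-torsion: with N = q d and t = t' d, the
    condition that N divides r t reduces to q dividing r, as q and t' are coprime.\<close>
  let ?B = "(\<lambda>j::nat. c [^] (q * j)) ` {..<d}"
  have inB: "v \<in> ?B" if v: "v \<in> generate G {c}" "v [^] ?t = \<one>" for v
  proof -
    obtain i :: int where i: "v = c [^] i" using v(1) generate_pow[OF c] by auto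
    define r where "r = nat (i mod int ?N)"
    have r: "int r = i mod int ?N" "r < ?N" unfolding r_def using N by (simp_all add: nat_less_iff)
    have "v = c [^] (i mod int ?N)"
      unfolding i using c by (simp add: int_pow_eq minus_mod_eq_mult_div [symmetric] mod_eq_dvd_iff [symmetric])
    then have vr: "v = c [^] r" using r(1) by (metis int_pow_int)
    then have "?N dvd r * ?t" using v(2) c by (simp add: nat_pow_pow pow_eq_id)
    then have "q * d dvd r * t' * d" using q(1,2) by (metis mult.assoc)
    then have "q dvd r * t'" using d0(1) by simp
    then have "q dvd r" using q(3) by (simp add: coprime_dvd_mult_left_iff)
    then obtain j where j: "r = q * j" by (auto elim: dvdE)
    then have "j < d" using r(2) q(1) by (metis mult_less_cancel1)
    then show ?thesis using vr j by blast
  qed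
  have "T \<subseteq> ?B" using inB Tt T(2) by blast
  moreover have "card ?B \<le> card T"
    using card_image_le[of "{..<d}" "\<lambda>j::nat. c [^] (q * j)"] d0(2) by simp
  ultimately have "T = ?B" by (intro card_seteq) auto
  then show ?thesis using inB[OF u] by simp
qed

lemma (in class_two_group) central_subset_of_cyclic:
  assumes fin: "finite (carrier G)" and Z: "derived G (carrier G) = center G"
    and cyc: "cyclic_group (G\<lparr>carrier := center G\<rparr>)"
  shows "central_auto G \<subseteq> class_preserving_auto G"
proof (rule central_subset_class_preserving)
  fix f x assume f: "f \<in> central_auto G" and x: "x \<in> carrier G"
  let ?Z = "center G" and ?T = "{commutator G x g | g. g \<in> carrier G}"
  let ?h = "\<lambda>x. inv x \<otimes> f x"
  interpret h: group_hom G G ?h by unfold_locales (rule central_auto_difference_hom[OF f])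
  obtain c where c: "c \<in> ?Z" "?Z = range (\<lambda>i::int. c [^]\<^bsub>G\<lparr>carrier := ?Z\<rparr>\<^esub> i)"
    using cyc group.cyclic_group[OF subgroup_imp_group[OF subgroup_center]] by auto
  note cc = centerD(1)[OF c(1)]
  have "?Z = range (\<lambda>i::int. c [^] i)"
    using c(2) int_pow_consistent[OF subgroup_center c(1)] by simp
  then have gen: "?Z = generate G {c}" using generate_pow[OF cc] by auto
  have T: "subgroup ?T G" by (rule commutator_set_subgroup[OF x])
  have TZ: "?T \<subseteq> ?Z" using commutator_central[OF x] by blast
  \<comment> \<open>With t = |[x, G]|, Lagrange's theorem gives [x^t, g] = [x, g]^t = 1. So x^t lies
    in the center, which is the derived subgroup, and there \<open>?h\<close> is trivial.\<close>
  have "x [^] card ?T \<in> ?Z"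
  proof (rule centerI_commutator)
    fix g assume g: "g \<in> carrier G"
    interpret H: group "G\<lparr>carrier := ?T\<rparr>" by (rule subgroup_imp_group[OF T])
    have "commutator G x g \<in> ?T" using g by blast
    then have "commutator G x g [^]\<^bsub>G\<lparr>carrier := ?T\<rparr>\<^esub> card ?T = \<one>"
      using H.pow_order_eq_1[of "commutator G x g"] by (simp add: order_def)
    then have "commutator G x g [^] card ?T = \<one>" by (simp add: nat_pow_consistent[symmetric])
    then show "commutator G (x [^] card ?T) g = \<one>" using x g by (simp add: commutator_pow_left)
  qed (use x in simp)
  then have "?h (x [^] card ?T) = \<one>" using central_auto_fixes_derived[OF f] Z by simp
  then have "?h x [^] card ?T = \<one>" using h.hom_nat_pow[OF x] by simp
  moreover have "?h x \<in> ?Z" using f x unfolding central_auto_def by auto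
  ultimately have "?h x \<in> ?T"
    using cyclic_torsion_in_subgroup[OF fin cc T] TZ gen by simp
  then show "\<exists>g \<in> carrier G. ?h x = commutator G x g" by auto
qed

text \<open>Central elements lie in the derived subgroup and are fixed. For any other x the Camina
  condition says that [x, G] contains the whole center, hence also x^(-1) f(x).\<close>

lemma (in group) central_subset_of_camina:
  assumes cam: "camina_pair G (derived G (carrier G))" and Z: "derived G (carrier G) = center G"
  shows "central_auto G \<subseteq> class_preserving_auto G"
proof (rule central_subset_class_preserving)
  fix f x assume f: "f \<in> central_auto G" and x: "x \<in> carrier G"
  have h: "inv x \<otimes> f x \<in> center G" using f x unfolding central_auto_def by auto
  show "\<exists>g \<in> carrier G. inv x \<otimes> f x = commutator G x g"
  proof (cases "x \<in> center G")
    case True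
    then have "inv x \<otimes> f x = commutator G x \<one>" using central_auto_fixes_derived[OF f] Z by simp
    then show ?thesis by blast
  next
    case False
    then show ?thesis using cam x h unfolding camina_pair_def Z by blast
  qed
qed

text \<open>Class 2 makes commutators central. Conversely, for a central z outside the derived
  subgroup the Camina condition would enclose that nontrivial subgroup in [z, G], which is
  trivial.\<close>

lemma (in group) derived_eq_center_of_camina:
  assumes cam: "camina_pair G (derived G (carrier G))" and nil: "has_nilpotency_class G 2"
  shows "derived G (carrier G) = center G"
proof
  let ?D = "derived G (carrier G)"
  show "?D \<subseteq> center G"
  proof
    fix c assume c: "c \<in> ?D"
    then have cc: "c \<in> carrier G" using subgroup.mem_carrier[OF subgroup_derived] by blast
    \<comment> \<open>With the shifted index this is the third term of the lower central series,
      generated by commutators of the derived subgroup with the group.\<close>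
    have "lower_central G (Suc 1) = {\<one>}" using nil by (simp add: has_nilpotency_class_def numeral_2_eq_2)
    then have gen: "generate G {commutator G x y | x y. x \<in> ?D \<and> y \<in> carrier G} = {\<one>}"
      unfolding lower_central.simps(2)[of G 1] lower_central_1 .
    have "commutator G c g = \<one>" if "g \<in> carrier G" for g
    proof -
      have "commutator G c g \<in> generate G {commutator G x y | x y. x \<in> ?D \<and> y \<in> carrier G}"
        using c that by (intro generate.incl) blast
      then show ?thesis unfolding gen by simp
    qed
    then show "c \<in> center G" by (rule centerI_commutator[OF cc])
  qed
  show "center G \<subseteq> ?D"
  proof (rule subsetI, rule ccontr)
    fix z assume z: "z \<in> center G" "z \<notin> ?D"
    then have "?D \<subseteq> {commutator G z g | g. g \<in> carrier G}"
      using cam centerD(1)[OF z(1)] unfolding camina_pair_def by blast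
    also have "\<dots> \<subseteq> {\<one>}" using z(1) by auto
    finally show False using cam subgroup.one_closed[OF subgroup_derived] unfolding camina_pair_def by blast
  qed
qed

lemma (in class_two_group) nilpotency_class_two:
  assumes nonab: "\<not> comm_group G"
  shows "has_nilpotency_class G 2"
proof -
  let ?D = "derived G (carrier G)"
  have ne: "?D \<noteq> {\<one>}"
  proof
    assume "?D = {\<one>}"
    then have "commutator G x y = \<one>" if "x \<in> carrier G" "y \<in> carrier G" for x y
      using commutator_in_derived[OF that] by simp
    then have "x \<otimes> y = y \<otimes> x" if "x \<in> carrier G" "y \<in> carrier G" for x y
      using mult_commutator[OF that] that by simp
    then show False using nonab group_comm_groupI by blast
  qed
  then have ne': "carrier G \<noteq> {\<one>}"
    using subgroup.subset[OF subgroup_derived] subgroup.one_closed[OF subgroup_derived] by blast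
  have "{commutator G x y | x y. x \<in> ?D \<and> y \<in> carrier G} \<subseteq> {\<one>}"
    using derived_subset_center by auto
  then have "generate G {commutator G x y | x y. x \<in> ?D \<and> y \<in> carrier G} \<subseteq> {\<one>}"
    by (rule generate_subgroup_incl[OF _ triv_subgroup])
  then have "generate G {commutator G x y | x y. x \<in> ?D \<and> y \<in> carrier G} = {\<one>}"
    using generate.one by blast
  then have "lower_central G (Suc 1) = {\<one>}"
    unfolding lower_central.simps(2)[of G 1] lower_central_1 .
  moreover have "lower_central G d \<noteq> {\<one>}" if "d < 2" for d
    using that ne ne' lower_central_1 by (cases d) (auto simp: less_Suc_eq numeral_2_eq_2)
  ultimately show ?thesis by (simp add: has_nilpotency_class_def numeral_2_eq_2)
qed

section \<open>Both directions of the characterization\<close>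

theorem theorem4p5:
  fixes G :: "('a, 'b) monoid_scheme" and p :: nat
  assumes "Factorial_Ring.prime p"
    and "group G"
    and "\<not> comm_group G"
    and "order G = p ^ 7"
  shows "class_preserving_auto G = central_auto G \<longleftrightarrow>
    (derived G (carrier G) = center G \<and> cyclic_group (G\<lparr>carrier := center G\<rparr>)) \<or>
    (camina_p_group p G \<and> has_nilpotency_class G 2)"
proof
  interpret group G by (rule assms(2))
  have fin: "finite (carrier G)"
    using assms(1,4) by (metis order_gt_0_iff_finite prime_gt_0_nat zero_less_power)
  {
    assume eq: "class_preserving_auto G = central_auto G"
    interpret class_two_group G
      by (rule class_two_of_class_preserving_subset) (simp add: eq)
    obtain e a b where "class_two_p_group G p 7 e a b"
      by (rule class_two_p_groupE[OF assms(1,4,3)])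
    then interpret class_two_p_group G p 7 e a b .
    have sub: "central_auto G \<subseteq> class_preserving_auto G" by (simp add: eq)
    have Z: "center G = derived G (carrier G)" by (rule center_eq_derived[OF sub])
    have nil: "has_nilpotency_class G 2" by (rule nilpotency_class_two[OF assms(3)])
    show "(derived G (carrier G) = center G \<and> cyclic_group (G\<lparr>carrier := center G\<rparr>)) \<or>
      (camina_p_group p G \<and> has_nilpotency_class G 2)"
    proof (cases "cyclic_group (G\<lparr>carrier := center G\<rparr>)")
      case False
      \<comment> \<open>The order p^7 enters here: 3e + 2 <= 7 and e > 0 leave only e = 1.\<close>
      then have "e = 1" using order_bound_noncyclic[OF Z] e_pos by simp
      note camina = camina_of_exponent_p[OF sub this]
      have low: "lower_central G d \<noteq> {\<one>\<^bsub>G\<^esub>}" if "d < 2" for d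
        using nil that by (simp add: has_nilpotency_class_def)
      have ne: "derived G (carrier G) \<noteq> {\<one>\<^bsub>G\<^esub>}"
        unfolding lower_central_1[symmetric] by (rule low) simp
      have "center G \<noteq> carrier G" using assms(3) group_comm_groupI centerD(2) by blast
      then have "camina_pair G (derived G (carrier G))"
        unfolding camina_pair_def using ne derived_self_is_normal camina Z by auto
      moreover have "finite_p_group p G" unfolding finite_p_group_def using assms by blast
      ultimately show ?thesis using nil by (simp add: camina_p_group_def)
    qed (use Z in simp)
  }
  assume "(derived G (carrier G) = center G \<and> cyclic_group (G\<lparr>carrier := center G\<rparr>)) \<or>
    (camina_p_group p G \<and> has_nilpotency_class G 2)"
  \<comment> \<open>Both alternatives give equality of center and derived subgroup, and hence class
    at most 2; they differ only in why central automorphisms are class preserving.\<close>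
  then have Z: "derived G (carrier G) = center G"
    and cases: "cyclic_group (G\<lparr>carrier := center G\<rparr>) \<or> camina_pair G (derived G (carrier G))"
    using derived_eq_center_of_camina by (auto simp: camina_p_group_def)
  interpret class_two_group G
    by (rule class_two_groupI) (use commutator_in_derived Z in blast)
  show "class_preserving_auto G = central_auto G"
    using cases class_preserving_subset_central central_subset_of_cyclic[OF fin Z]
      central_subset_of_camina[OF _ Z] by blast
qed

end
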